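(* Let $m,p,L,N,T,T_{\mathrm{ini}},T_{\mathrm{f}}\in\mathbb{Z}_{\ge 0}$ and let $\mathcal{B}^*\in\mathsf{LTI}^{m,p}$ satisfy $\ell(\mathcal{B}^* )\le L$ and $n(\mathcal{B}^* )\le N$. Let $(u^{\mathrm d},y^{\mathrm d})\in\mathcal{B}^*_{[0,T-1]}$, $(u^{\mathrm{ini}},y^{\mathrm{ini}})\in\mathcal{B}^*_{[0,T_{\mathrm{ini}}-1]}$, and $u^{\mathrm f}\in\mathbb{R}^{mT_{\mathrm f}}$. If $T_{\mathrm{ini}}\ge L_{\max}$ and the procedure $\textsc{Predict}(u^{\mathrm d},y^{\mathrm d},u^{\mathrm{ini}},y^{\mathrm{ini}},u^{\mathrm f},L_{\max})$ returns a vector $y^{\mathrm f}$ (i.e. does not return null), then $(u^{\mathrm d},y^{\mathrm d})$ is informative for unique prediction of $u^{\mathrm f}$ from $(u^{\mathrm{ini}},y^{\mathrm{ini}})$ and $y^{\mathrm f}$ is the unique prediction.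
   Context: **Behaviors.** Consider linear time-invariant systems $x(t+1)=Ax(t)+Bu(t)$, $y(t)=Cx(t)+Du(t)$, $t\in\mathbb{Z}_{\ge0}$, with real matrices $A\in\mathbb{R}^{n\times n}$, $B\in\mathbb{R}^{n\times m}$, $C\in\mathbb{R}^{p\times n}$, $D\in\mathbb{R}^{p\times m}$ ($n\in\mathbb{Z}_{\ge0}$; $n=0$ means a static system $y=Du$). The behavior of the system is $\mathcal{B}=\{(u,y)\in(\mathbb{R}^m)^{\mathbb{Z}_{\ge0}}\times(\mathbb{R}^p)^{\mathbb{Z}_{\ge0}} \mid \exists x\in(\mathbb{R}^n)^{\mathbb{Z}_{\ge0}}$ such that the system equations hold for all $t\in\mathbb{Z}_{\ge0}\}$; the system is called a state-space representation of $\mathcal{B}$. $\mathsf{LTI}^{m,p}$ is the set of all such behaviors with $m$ inputs and $p$ outputs (any $n$). $n(\mathcal{B})$ is the smallest state dimension among all state-space representations of $\mathcal{B}$; a representation attaining it is minimal. With $\mathcal{O}_0$ the $0\times n$ void matrix (rank $0$) and $\mathcal{O}_k=\begin{pmatrix} C \\ C A \\ \vdots \\ C A^{k-1} \end{pmatrix}$ for $k>0$, the lag is $\ell(\mathcal{B})=\min\{k\in\mathbb{Z}_{\ge0}\mid \operatorname{rank}\mathcal{O}_k=\operatorname{rank}\mathcal{O}_{k+1}\}$, computed from a minimal representation of $\mathcal{B}$. **Restrictions.** $w_{[t_0,t_1]}=(w(t_0),\dots,w(t_1))$ is a stacked column vector, and $\mathcal{B}_{[t_0,t_1]}=\{(u_{[t_0,t_1]},y_{[t_0,t_1]})\mid(u,y)\in\mathcal{B}\}$.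 The notation $(u^{\mathrm{ini}},u^{\mathrm f},y^{\mathrm{ini}},y^{\mathrm f})\in\mathcal{B}_{[0,T_{\mathrm{ini}}+T_{\mathrm f}-1]}$ means that the pair consisting of the concatenated input $(u^{\mathrm{ini}},u^{\mathrm f})$ and concatenated output $(y^{\mathrm{ini}},y^{\mathrm f})$ belongs to the restricted behavior. **Explaining systems.** $\mathcal{M}=\{\mathcal{B}\in\mathsf{LTI}^{m,p}\mid \ell(\mathcal{B})\le L,\ n(\mathcal{B})\le N\}$. For a length-$T'$ pair $(\bar u,\bar y)$, $\Sigma(\bar u,\bar y)=\{\mathcal{B}\in\mathcal{M}\mid(\bar u,\bar y)\in\mathcal{B}_{[0,T'-1]}\}$. Put $\Sigma_{\mathrm d}=\Sigma(u^{\mathrm d},y^{\mathrm d})$, $\Sigma_{\mathrm{ini}}=\Sigma(u^{\mathrm{ini}},y^{\mathrm{ini}})$, and $L_{\max}=\max\{\ell(\mathcal{B})\mid\mathcal{B}\in\Sigma_{\mathrm d}\cap\Sigma_{\mathrm{ini}}\}$. **Informativity.** $(u^{\mathrm d},y^{\mathrm d})$ is informative for unique prediction of $u^{\mathrm f}$ from $(u^{\mathrm{ini}},y^{\mathrm{ini}})$ if (i) for every $\mathcal{B}\in\Sigma_{\mathrm d}\cap\Sigma_{\mathrm{ini}}$ there exists a unique $y^{\mathrm f}\in\mathbb{R}^{pT_{\mathrm f}}$ with $(u^{\mathrm{ini}},u^{\mathrm f},y^{\mathrm{ini}},y^{\mathrm f})\in\mathcal{B}_{[0,T_{\mathrm{ini}}+T_{\mathrm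 f}-1]}$; and (ii) there exists $y^{\mathrm f}\in\mathbb{R}^{pT_{\mathrm f}}$ with $(u^{\mathrm{ini}},u^{\mathrm f},y^{\mathrm{ini}},y^{\mathrm f})\in\mathcal{B}_{[0,T_{\mathrm{ini}}+T_{\mathrm f}-1]}$ for all $\mathcal{B}\in\Sigma_{\mathrm d}\cap\Sigma_{\mathrm{ini}}$. In that case the (necessarily unique) $y^{\mathrm f}$ in (ii) is called the unique prediction. **Hankel matrices.** For $w=(w(0),\dots,w(T'-1))$ with $w(t)\in\mathbb{R}^q$, $\mathcal{H}_k(w)$ is the $qk\times0$ void matrix if $T'<k$, and for $T'\ge k$ is the $qk\times(T'-k+1)$ matrix whose $j$-th column ($j=0,\dots,T'-k$) is $(w(j),w(j+1),\dots,w(j+k-1))$. The image of a void matrix with zero columns is $\{0\}$. **Procedure $\textsc{Predict}(u^{\mathrm d},y^{\mathrm d},u^{\mathrm{ini}},y^{\mathrm{ini}},u^{\mathrm f},\ell)$**, where $(u^{\mathrm{ini}},y^{\mathrm{ini}})$ has length $T_{\mathrm{ini}}\ge\ell$ and $u^{\mathrm f}$ has length $T_{\mathrm f}$. Partition $$\begin{pmatrix} U_{\mathrm p} \\ U_{\mathrm f} \\ Y_{\mathrm p} \\ Y_{\mathrm f} \end{pmatrix}=\begin{pmatrix} \mathcal{H}_{\ell+T_{\mathrm f}}(u^{\mathrm d}) & \mathcal{H}_{\ell+T_{\mathrm f}}(u^{\mathrm{ini}}) \\ \mathcal{H}_{\ell+T_{\mathrm f}}(y^{\mathrm d}) & \mathcal{H}_{\ell+T_{\mathrm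 f}}(y^{\mathrm{ini}}) \end{pmatrix}$$ with $U_{\mathrm p},U_{\mathrm f},Y_{\mathrm p},Y_{\mathrm f}$ having $m\ell,\ mT_{\mathrm f},\ p\ell,\ pT_{\mathrm f}$ rows respectively. Let $\bar u^{\mathrm{ini}}=u^{\mathrm{ini}}_{[T_{\mathrm{ini}}-\ell,T_{\mathrm{ini}}-1]}$, $\bar y^{\mathrm{ini}}=y^{\mathrm{ini}}_{[T_{\mathrm{ini}}-\ell,T_{\mathrm{ini}}-1]}$. If there is a vector $g$ with $U_{\mathrm p}g=\bar u^{\mathrm{ini}}$, $U_{\mathrm f}g=u^{\mathrm f}$, $Y_{\mathrm p}g=\bar y^{\mathrm{ini}}$, return $Y_{\mathrm f}g$ for such a $g$ (any choice); otherwise return null. *)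

theory Defs
  imports Complex_Main "Jordan_Normal_Form.DL_Rank"
begin

type_synonym signal = "nat \<Rightarrow> real vec"
type_synonym behavior = "(signal \<times> signal) set"

definition is_system :: "nat \<Rightarrow> nat \<Rightarrow> nat \<Rightarrow> real mat \<Rightarrow> real mat \<Rightarrow> real mat \<Rightarrow> real mat \<Rightarrow> bool" where
  "is_system n m p A B C D \<longleftrightarrow>
     A \<in> carrier_mat n n \<and> B \<in> carrier_mat n m \<and> C \<in> carrier_mat p n \<and> D \<in> carrier_mat p m"

definition system_behavior ::
  "nat \<Rightarrow> nat \<Rightarrow> nat \<Rightarrow> real mat \<Rightarrow> real mat \<Rightarrow> real mat \<Rightarrow> real mat \<Rightarrow> behavior" where
  "system_behavior n m p A B C D =
     {(u, y). (\<forall>t. u t \<in> carrier_vec m) \<and> (\<forall>t. y t \<in> carrier_vec p) \<and>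
        (\<exists>x. (\<forall>t. x t \<in> carrier_vec n) \<and>
             (\<forall>t. x (t + 1) = A *\<^sub>v x t + B *\<^sub>v u t \<and> y t = C *\<^sub>v x t + D *\<^sub>v u t))}"

definition represents ::
  "nat \<Rightarrow> nat \<Rightarrow> nat \<Rightarrow> real mat \<Rightarrow> real mat \<Rightarrow> real mat \<Rightarrow> real mat \<Rightarrow> behavior \<Rightarrow> bool" where
  "represents n m p A B C D \<B> \<longleftrightarrow> is_system n m p A B C D \<and> \<B> = system_behavior n m p A B C D"

definition LTI :: "nat \<Rightarrow> nat \<Rightarrow> behavior set" where
  "LTI m p = {\<B>. \<exists>n A B C D. represents n m p A B C D \<B>}"

definition state_dim :: "nat \<Rightarrow> nat \<Rightarrow> behavior \<Rightarrow> nat" where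
  "state_dim m p \<B> = (LEAST n. \<exists>A B C D. represents n m p A B C D \<B>)"

definition minimal_rep ::
  "nat \<Rightarrow> nat \<Rightarrow> real mat \<Rightarrow> real mat \<Rightarrow> real mat \<Rightarrow> real mat \<Rightarrow> behavior \<Rightarrow> bool" where
  "minimal_rep m p A B C D \<B> \<longleftrightarrow> represents (state_dim m p \<B>) m p A B C D \<B>"

fun observability_mat :: "real mat \<Rightarrow> real mat \<Rightarrow> nat \<Rightarrow> real mat" where
  "observability_mat A C 0 = 0\<^sub>m 0 (dim_row A)"
| "observability_mat A C (Suc k) = observability_mat A C k @\<^sub>r (C * A ^\<^sub>m k)"

definition mat_rank :: "real mat \<Rightarrow> nat" where
  "mat_rank M = vec_space.rank (dim_row M) M"

definition system_lag :: "real mat \<Rightarrow> real mat \<Rightarrow> nat" where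
  "system_lag A C =
     (LEAST k. mat_rank (observability_mat A C k) = mat_rank (observability_mat A C (k + 1)))"

(* The choice of minimal representation is immaterial: the image of the k-th observability matrix
   is the set of restrictions to {0..<k} of the outputs y with (0, y) in the behavior. *)
definition lag :: "nat \<Rightarrow> nat \<Rightarrow> behavior \<Rightarrow> nat" where
  "lag m p \<B> = (SOME l. \<exists>A B C D. minimal_rep m p A B C D \<B> \<and> l = system_lag A C)"

(* A finite sequence w(0), ..., w(T-1) in R^q is stored as one stacked vector of dimension q * T,
   with component i of w(t) at position q * t + i. The length T is always passed explicitly,
   since it cannot be recovered from the stacked vector when q = 0. *)
definition stack :: "nat \<Rightarrow> nat \<Rightarrow> signal \<Rightarrow> real vec" where
  "stack q T w = vec (q * T) (\<lambda>i. w (i div q) $ (i mod q))"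

(* Restriction to the T time steps 0, ..., T-1. *)
definition restr :: "nat \<Rightarrow> nat \<Rightarrow> behavior \<Rightarrow> nat \<Rightarrow> (real vec \<times> real vec) set" where
  "restr m p \<B> T = {(stack m T u, stack p T y) | u y. (u, y) \<in> \<B>}"

definition model_class :: "nat \<Rightarrow> nat \<Rightarrow> nat \<Rightarrow> nat \<Rightarrow> behavior set" where
  "model_class m p L N = {\<B> \<in> LTI m p. lag m p \<B> \<le> L \<and> state_dim m p \<B> \<le> N}"

definition explaining ::
  "nat \<Rightarrow> nat \<Rightarrow> nat \<Rightarrow> nat \<Rightarrow> nat \<Rightarrow> real vec \<Rightarrow> real vec \<Rightarrow> behavior set" where
  "explaining m p L N T u y = {\<B> \<in> model_class m p L N. (u, y) \<in> restr m p \<B> T}"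

definition L_max ::
  "nat \<Rightarrow> nat \<Rightarrow> nat \<Rightarrow> nat \<Rightarrow> nat \<Rightarrow> nat \<Rightarrow>
   real vec \<Rightarrow> real vec \<Rightarrow> real vec \<Rightarrow> real vec \<Rightarrow> nat" where
  "L_max m p L N T Tini ud yd uini yini =
     Max {lag m p \<B> | \<B>. \<B> \<in> explaining m p L N T ud yd \<inter> explaining m p L N Tini uini yini}"

definition common_prediction ::
  "nat \<Rightarrow> nat \<Rightarrow> nat \<Rightarrow> nat \<Rightarrow> nat \<Rightarrow> nat \<Rightarrow> nat \<Rightarrow>
   real vec \<Rightarrow> real vec \<Rightarrow> real vec \<Rightarrow> real vec \<Rightarrow> real vec \<Rightarrow> real vec \<Rightarrow> bool" where
  "common_prediction m p L N T Tini Tf ud yd uini yini uf yf \<longleftrightarrow>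
     yf \<in> carrier_vec (p * Tf) \<and>
     (\<forall>\<B> \<in> explaining m p L N T ud yd \<inter> explaining m p L N Tini uini yini.
        (uini @\<^sub>v uf, yini @\<^sub>v yf) \<in> restr m p \<B> (Tini + Tf))"

definition informative ::
  "nat \<Rightarrow> nat \<Rightarrow> nat \<Rightarrow> nat \<Rightarrow> nat \<Rightarrow> nat \<Rightarrow> nat \<Rightarrow>
   real vec \<Rightarrow> real vec \<Rightarrow> real vec \<Rightarrow> real vec \<Rightarrow> real vec \<Rightarrow> bool" where
  "informative m p L N T Tini Tf ud yd uini yini uf \<longleftrightarrow>
     (\<forall>\<B> \<in> explaining m p L N T ud yd \<inter> explaining m p L N Tini uini yini.
        \<exists>!yf. yf \<in> carrier_vec (p * Tf) \<and>
              (uini @\<^sub>v uf, yini @\<^sub>v yf) \<in> restr m p \<B> (Tini + Tf)) \<and>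
     (\<exists>yf. common_prediction m p L N T Tini Tf ud yd uini yini uf yf)"

definition unique_prediction ::
  "nat \<Rightarrow> nat \<Rightarrow> nat \<Rightarrow> nat \<Rightarrow> nat \<Rightarrow> nat \<Rightarrow> nat \<Rightarrow>
   real vec \<Rightarrow> real vec \<Rightarrow> real vec \<Rightarrow> real vec \<Rightarrow> real vec \<Rightarrow> real vec" where
  "unique_prediction m p L N T Tini Tf ud yd uini yini uf =
     (THE yf. common_prediction m p L N T Tini Tf ud yd uini yini uf yf)"

definition hankel :: "nat \<Rightarrow> nat \<Rightarrow> nat \<Rightarrow> real vec \<Rightarrow> real mat" where
  "hankel q T k w =
     (if T < k then 0\<^sub>m (q * k) 0 else mat (q * k) (T - k + 1) (\<lambda>(i, j). w $ (q * j + i)))"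

definition row_block :: "real mat \<Rightarrow> nat \<Rightarrow> nat \<Rightarrow> real mat" where
  "row_block M r k = mat k (dim_col M) (\<lambda>(i, j). M $$ (r + i, j))"

(* The set of admissible return values of the procedure, None standing for null: any solution g
   may be picked. *)
definition predict ::
  "nat \<Rightarrow> nat \<Rightarrow> nat \<Rightarrow> nat \<Rightarrow> nat \<Rightarrow>
   real vec \<Rightarrow> real vec \<Rightarrow> real vec \<Rightarrow> real vec \<Rightarrow> real vec \<Rightarrow> nat \<Rightarrow> real vec option set" where
  "predict m p T Tini Tf ud yd uini yini uf l =
     (let k = l + Tf;
          M = four_block_mat (hankel m T k ud) (hankel m Tini k uini)
                             (hankel p T k yd) (hankel p Tini k yini);
          Up = row_block M 0 (m * l);
          Uf = row_block M (m * l) (m * Tf);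
          Yp = row_block M (m * k) (p * l);
          Yf = row_block M (m * k + p * l) (p * Tf);
          G = {g \<in> carrier_vec (dim_col M). Up *\<^sub>v g = vec_last uini (m * l) \<and>
                 Uf *\<^sub>v g = uf \<and> Yp *\<^sub>v g = vec_last yini (p * l)}
      in if G = {} then {None} else {Some (Yf *\<^sub>v g) | g. g \<in> G})"

end

theory Submission
  imports Defs "Jordan_Normal_Form.Matrix_Kernel"
begin

text \<open>By rank-nullity, equality of the ranks of two consecutive observability matrices means equality of
  their kernels, hence an output of an autonomous system that vanishes up to the lag vanishes forever.
  Consequently a trajectory of \<open>\<B>\<close> is determined by its input and by its first \<open>l\<close> outputs whenever
  \<open>l \<ge> lag \<B>\<close>. The Hankel columns are windows of trajectories of every explaining \<open>\<B>\<close>, and \<open>\<B>\<close> is a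
  shift-invariant linear space, so the linear combination with coefficients \<open>g\<close> is a trajectory of
  \<open>\<B>\<close> too. It starts with the last \<open>l = L_max\<close> samples of the initial data, followed by the input
  \<open>uf\<close>, and so its output agrees with that of any continuation of the initial data by \<open>uf\<close>.\<close>

section \<open>Rank-nullity and nested kernels of matrices\<close>

text \<open>Rank-nullity for the linear map given by \<open>M\<close>: its kernel is
  \<open>mat_kernel M\<close> and its image is the column space, whose dimension is the
  rank.\<close>

lemma rank_plus_kernel_dim:
  fixes M :: "'a :: field mat"
  assumes M: "M \<in> carrier_mat nr nc"
  shows "vec_space.rank nr M + kernel_dim M = nc"
proof -
  interpret V: vec_space "TYPE('a)" nc .
  interpret W: vec_space "TYPE('a)" nr .
  interpret K: kernel nr nc M by (unfold_locales, rule M)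
  interpret T: linear_map class_ring "module_vec TYPE('a) nc" "module_vec TYPE('a) nr" "(*\<^sub>v) M"
    by unfold_locales
      (use M in \<open>auto simp: LinearCombinations.module_hom_def module_vec_simps mult_add_distrib_mat_vec\<close>)
  have ker: "T.kerT = mat_kernel M"
    unfolding T.ker_def mat_kernel[OF M] by (simp add: module_vec_simps)
  have im: "T.imT = W.span (set (cols M))"
    using W.col_space_eq[OF M] M unfolding T.im_def W.col_space_def by (auto simp: module_vec_simps)
  show ?thesis
    using T.rank_nullity[OF V.fin_dim] unfolding ker im V.dim_is_n
    by (simp add: W.rank_def)
qed

text \<open>A basis of the smaller kernel is an independent set in the larger one with at least as
  many elements as the dimension there, hence a basis of both.\<close>

lemma mat_kernel_eq_if_subset_dim_le:
  fixes M M' :: "'a :: field mat"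
  assumes M: "M \<in> carrier_mat nr nc" and M': "M' \<in> carrier_mat nr' nc"
    and sub: "mat_kernel M' \<subseteq> mat_kernel M"
    and dim: "kernel_dim M \<le> kernel_dim M'"
  shows "mat_kernel M' = mat_kernel M"
proof -
  interpret K: kernel nr nc M by (unfold_locales, rule M)
  interpret K': kernel nr' nc M' by (unfold_locales, rule M')
  obtain B' where B': "finite B'" "K'.basis B'" using kernel_basis_exists[OF M'] by blast
  obtain B where B: "finite B" "K.basis B" using kernel_basis_exists[OF M] by blast
  have B'_sub: "B' \<subseteq> mat_kernel M'" and indep: "K'.lin_indpt B'" and span: "K'.span B' = mat_kernel M'"
    using B'(2) unfolding K'.Ker.basis_def by auto
  have fin: "K.Ker.fin_dim"
    using B unfolding K.Ker.fin_dim_def K.Ker.basis_def by auto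
  have "K.basis B'"
  proof (rule K.Ker.dim_li_is_basis[OF fin B'(1)])
    show "B' \<subseteq> mat_kernel M" using B'_sub sub by blast
    \<comment> \<open>Each kernel is a vector space of its own; independence here, and the span
      below, are transferred through the ambient space of all vectors.\<close>
    show "K.lin_indpt B'"
      using indep K'.lindep_same[OF B'_sub] K.lindep_same[of B'] B'_sub sub by auto
    show "K.dim \<le> card B'"
      using dim K'.Ker.dim_basis[OF B'] by simp
  qed
  then have "mat_kernel M = K.span B'" unfolding K.Ker.basis_def by auto
  also have "\<dots> = K'.span B'"
    using K.span_same[of B'] K'.span_same[OF B'_sub] B'_sub sub by auto
  finally show ?thesis using span by simp
qed

lemma kernel_dim_cong:
  fixes M M' :: "'a :: field mat"
  assumes "mat_kernel M' = mat_kernel M" "dim_col M' = dim_col M"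
  shows "kernel_dim M' = kernel_dim M"
  using assms by (simp add: kernel_dim_def)

section \<open>Observability matrices and autonomous trajectories\<close>

lemma observability_mat_carrier:
  assumes "A \<in> carrier_mat n n" "C \<in> carrier_mat p n"
  shows "observability_mat A C k \<in> carrier_mat (k * p) n"
proof (induction k)
  case (Suc k)
  have "C * A ^\<^sub>m k \<in> carrier_mat p n"
    using assms by auto
  from carrier_append_rows[OF Suc.IH this] show ?case
    by (simp add: add.commute)
qed (use assms in simp)

lemma autonomous_state_eq_pow:
  assumes A: "A \<in> carrier_mat n n"
    and x: "\<And>t. x t \<in> carrier_vec n" "\<And>t. x (Suc t) = A *\<^sub>v x t"
  shows "x (s + i) = A ^\<^sub>m i *\<^sub>v x s"
proof (induction i arbitrary: s)
  case 0
  show ?case using A x(1)[of s] by simp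
next
  case (Suc i)
  have "x (s + Suc i) = A ^\<^sub>m i *\<^sub>v x (Suc s)"
    using Suc.IH[of "Suc s"] by simp
  also have "\<dots> = A ^\<^sub>m Suc i *\<^sub>v x s"
    using A x(1)[of s] by (simp add: x(2) assoc_mult_mat_vec[of _ n n _ n])
  finally show ?case .
qed

lemma append_vec_eq_zero_iff:
  assumes "v \<in> carrier_vec a" "w \<in> carrier_vec b"
  shows "v @\<^sub>v w = 0\<^sub>v (a + b) \<longleftrightarrow> v = 0\<^sub>v a \<and> w = 0\<^sub>v b"
proof -
  have "0\<^sub>v (a + b) = 0\<^sub>v a @\<^sub>v (0\<^sub>v b :: 'a vec)" by auto
  then show ?thesis using assms append_vec_eq[of v a "0\<^sub>v a" w "0\<^sub>v b"] by simp
qed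

text \<open>Block \<open>i\<close> of the observability matrix sends \<open>x s\<close> to
  \<open>C A^i x(s)\<close>, the output at time \<open>s + i\<close>. The free starting time
  \<open>s\<close> makes the kernels applicable to any window of \<open>k\<close> outputs.\<close>

lemma autonomous_state_in_kernel_iff:
  assumes A: "A \<in> carrier_mat n n" and C: "C \<in> carrier_mat p n"
    and x: "\<And>t. x t \<in> carrier_vec n" "\<And>t. x (Suc t) = A *\<^sub>v x t"
  shows "x s \<in> mat_kernel (observability_mat A C k) \<longleftrightarrow> (\<forall>i<k. C *\<^sub>v x (s + i) = 0\<^sub>v p)"
proof -
  have "observability_mat A C k *\<^sub>v x s = 0\<^sub>v (k * p) \<longleftrightarrow> (\<forall>i<k. C *\<^sub>v x (s + i) = 0\<^sub>v p)"
  proof (induction k)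
    case 0
    then show ?case using A by (auto intro!: eq_vecI)
  next
    case (Suc k)
    have CA: "C * A ^\<^sub>m k \<in> carrier_mat p n" using A C by auto
    note O = observability_mat_carrier[OF A C, of k]
    have "C *\<^sub>v x (s + k) = (C * A ^\<^sub>m k) *\<^sub>v x s"
      using autonomous_state_eq_pow[where x = x, OF A x, of s k] A C x(1)[of s]
      by (simp add: assoc_mult_mat_vec[of _ p n _ n])
    moreover have "observability_mat A C (Suc k) *\<^sub>v x s =
        (observability_mat A C k *\<^sub>v x s) @\<^sub>v ((C * A ^\<^sub>m k) *\<^sub>v x s)"
      using mat_mult_append[OF O CA x(1)] by simp
    moreover have "(observability_mat A C k *\<^sub>v x s) \<in> carrier_vec (k * p)"
      "(C * A ^\<^sub>m k) *\<^sub>v x s \<in> carrier_vec p"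
      using O CA x(1)[of s] by (auto simp del: observability_mat.simps)
    ultimately show ?case
      using Suc.IH append_vec_eq_zero_iff[of _ "k * p" _ p] by (simp add: add.commute less_Suc_eq all_conj_distrib) blast
  qed
  then show ?thesis
    using x(1)[of s] mat_kernel[OF observability_mat_carrier[OF A C]] by simp
qed

lemma mat_rank_plus_kernel_dim_observability:
  assumes A: "A \<in> carrier_mat n n" and C: "C \<in> carrier_mat p n"
  shows "mat_rank (observability_mat A C k) + kernel_dim (observability_mat A C k) = n"
  using rank_plus_kernel_dim[OF observability_mat_carrier[OF A C, of k]]
    observability_mat_carrier[OF A C, of k]
  by (simp add: mat_rank_def)

lemma mat_kernel_append_rows_subset:
  fixes M M' :: "'a :: field mat"
  assumes M: "M \<in> carrier_mat r n" and M': "M' \<in> carrier_mat r' n"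
  shows "mat_kernel (M @\<^sub>r M') \<subseteq> mat_kernel M"
proof
  fix v assume v: "v \<in> mat_kernel (M @\<^sub>r M')"
  note v = mat_kernelD[OF carrier_append_rows[OF M M'] v]
  have "(M *\<^sub>v v) @\<^sub>v (M' *\<^sub>v v) = 0\<^sub>v (r + r')"
    using v mat_mult_append[OF M M'] by simp
  then have "M *\<^sub>v v = 0\<^sub>v r"
    using append_vec_eq_zero_iff[of "M *\<^sub>v v" r "M' *\<^sub>v v" r'] M M' v(1) by simp
  then show "v \<in> mat_kernel M" using mat_kernelI[OF M v(1)] by blast
qed

lemma mat_kernel_observability_Suc_subset:
  assumes A: "A \<in> carrier_mat n n" and C: "C \<in> carrier_mat p n"
  shows "mat_kernel (observability_mat A C (Suc k)) \<subseteq> mat_kernel (observability_mat A C k)"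
  unfolding observability_mat.simps
  by (rule mat_kernel_append_rows_subset[OF observability_mat_carrier[OF A C]]) (use A C in auto)

text \<open>Without stagnation the nested kernels would shrink strictly at every step, and their
  dimensions would decrease forever. This guarantees that the minimum in \<open>system_lag\<close>
  is attained.\<close>

lemma mat_rank_observability_stabilises:
  assumes A: "A \<in> carrier_mat n n" and C: "C \<in> carrier_mat p n"
  shows "\<exists>k. mat_rank (observability_mat A C k) = mat_rank (observability_mat A C (k + 1))"
proof (rule ccontr)
  let ?O = "observability_mat A C"
  assume neq: "\<not> ?thesis"
  note O = observability_mat_carrier[OF A C]
  have decr: "kernel_dim (?O (Suc k)) < kernel_dim (?O k)" for k
  proof (rule ccontr)
    assume "\<not> ?thesis"
    then have "mat_kernel (?O (Suc k)) = mat_kernel (?O k)"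
      by (intro mat_kernel_eq_if_subset_dim_le[OF O O mat_kernel_observability_Suc_subset[OF A C]]) linarith
    then have "kernel_dim (?O (Suc k)) = kernel_dim (?O k)"
      by (rule kernel_dim_cong) (metis O carrier_matD(2))
    then show False
      using neq mat_rank_plus_kernel_dim_observability[OF A C, of k]
        mat_rank_plus_kernel_dim_observability[OF A C, of "Suc k"] by (metis Suc_eq_plus1 add_right_cancel)
  qed
  have "k + kernel_dim (?O k) \<le> kernel_dim (?O 0)" for k
  proof (induction k)
    case (Suc k)
    then show ?case using decr[of k] by linarith
  qed simp
  \<comment> \<open>One step more than the initial dimension already violates the bound.\<close>
  from this[of "Suc (kernel_dim (?O 0))"] show False by simp
qed

text \<open>Let \<open>l\<close> be the system lag, so that the kernels for \<open>l\<close> and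
  \<open>l + 1\<close> coincide. At a time \<open>t\<close> not below \<open>l\<close>, the
  \<open>l\<close> preceding outputs vanish by strong induction, so \<open>x (t - l)\<close> lies in
  the first kernel, hence in the second, whose additional equation is that the output at
  \<open>t\<close> vanishes.\<close>

lemma output_zero_beyond_system_lag:
  assumes A: "A \<in> carrier_mat n n" and C: "C \<in> carrier_mat p n"
    and x: "\<And>t. x t \<in> carrier_vec n" "\<And>t. x (Suc t) = A *\<^sub>v x t"
    and zero: "\<And>t. t < system_lag A C \<Longrightarrow> C *\<^sub>v x t = 0\<^sub>v p"
  shows "C *\<^sub>v x t = 0\<^sub>v p"
proof (induction t rule: less_induct)
  case (less t)
  define l where "l = system_lag A C"
  let ?O = "observability_mat A C"
  note O = observability_mat_carrier[OF A C]
  have "mat_rank (?O l) = mat_rank (?O (l + 1))"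
    unfolding l_def system_lag_def by (rule LeastI_ex[OF mat_rank_observability_stabilises[OF A C]])
  then have "kernel_dim (?O l) = kernel_dim (?O (Suc l))"
    using mat_rank_plus_kernel_dim_observability[OF A C, of l] mat_rank_plus_kernel_dim_observability[OF A C, of "Suc l"]
    by (metis Suc_eq_plus1 add_left_cancel)
  then have ker: "mat_kernel (?O (Suc l)) = mat_kernel (?O l)"
    by (intro mat_kernel_eq_if_subset_dim_le[OF O O mat_kernel_observability_Suc_subset[OF A C]]) linarith
  show ?case
  proof (cases "t < l")
    case True
    then show ?thesis using zero l_def by simp
  next
    case False
    then have "x (t - l) \<in> mat_kernel (?O l)"
      using autonomous_state_in_kernel_iff[where x = x, OF A C x, of "t - l" l] less by simp
    then have "x (t - l) \<in> mat_kernel (?O (Suc l))" using ker by blast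
    then show ?thesis
      using autonomous_state_in_kernel_iff[where x = x, OF A C x, of "t - l" "Suc l"] False by force
  qed
qed

section \<open>LTI behaviors: superposition, shift, causality and the lag\<close>

text \<open>\<open>lag\<close> selects one value among those of the minimal representations; such
  representations exist, so the selected value comes with matrices that realise it.\<close>

lemma LTI_representation_of_lag:
  assumes "\<B> \<in> LTI m p"
  obtains n A B C D where "is_system n m p A B C D" "\<B> = system_behavior n m p A B C D"
    "lag m p \<B> = system_lag A C"
proof -
  have "\<exists>n A B C D. represents n m p A B C D \<B>"
    using assms unfolding LTI_def by blast
  then have "\<exists>A B C D. represents (state_dim m p \<B>) m p A B C D \<B>"
    unfolding state_dim_def by (rule LeastI_ex)
  then have "\<exists>l A B C D. minimal_rep m p A B C D \<B> \<and> l = system_lag A C"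
    unfolding minimal_rep_def by blast
  then have "\<exists>A B C D. minimal_rep m p A B C D \<B> \<and> lag m p \<B> = system_lag A C"
    unfolding lag_def by (rule someI_ex)
  then show ?thesis using that unfolding minimal_rep_def represents_def by blast
qed

text \<open>Exposes the state as an argument, so that superposition, shift and change of input can
  be proved by naming the new state sequence.\<close>

definition state_trajectory ::
  "nat \<Rightarrow> real mat \<Rightarrow> real mat \<Rightarrow> real mat \<Rightarrow> real mat \<Rightarrow> signal \<Rightarrow> signal \<Rightarrow> signal \<Rightarrow> bool" where
  "state_trajectory n A B C D u x y \<longleftrightarrow>
     (\<forall>t. x t \<in> carrier_vec n \<and> x (Suc t) = A *\<^sub>v x t + B *\<^sub>v u t \<and> y t = C *\<^sub>v x t + D *\<^sub>v u t)"

lemma mem_system_behavior_iff: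
  "(u, y) \<in> system_behavior n m p A B C D \<longleftrightarrow>
     (\<forall>t. u t \<in> carrier_vec m) \<and> (\<forall>t. y t \<in> carrier_vec p) \<and> (\<exists>x. state_trajectory n A B C D u x y)"
  unfolding system_behavior_def state_trajectory_def by auto

lemma LTI_carrier:
  assumes "\<B> \<in> LTI m p" "(u, y) \<in> \<B>"
  shows "u t \<in> carrier_vec m" "y t \<in> carrier_vec p"
  using assms by (auto simp: LTI_def represents_def mem_system_behavior_iff)

lemma LTI_zero:
  assumes "\<B> \<in> LTI m p"
  shows "(\<lambda>_. 0\<^sub>v m, \<lambda>_. 0\<^sub>v p) \<in> \<B>"
proof -
  obtain n A B C D where sys: "is_system n m p A B C D" and \<B>: "\<B> = system_behavior n m p A B C D"
    using assms unfolding LTI_def represents_def by blast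
  have "state_trajectory n A B C D (\<lambda>_. 0\<^sub>v m) (\<lambda>_. 0\<^sub>v n) (\<lambda>_. 0\<^sub>v p)"
    using sys unfolding is_system_def state_trajectory_def by auto
  then show ?thesis unfolding \<B> mem_system_behavior_iff by auto
qed

lemma mult_mat_vec_axpy:
  fixes M :: "'a :: field mat"
  assumes "M \<in> carrier_mat r n" "x1 \<in> carrier_vec n" "x2 \<in> carrier_vec n"
  shows "M *\<^sub>v (x1 + c \<cdot>\<^sub>v x2) = M *\<^sub>v x1 + c \<cdot>\<^sub>v (M *\<^sub>v x2)"
  using assms mult_add_distrib_mat_vec[of M r n x1 "c \<cdot>\<^sub>v x2"] mult_mat_vec[of M r n x2 c] by simp

text \<open>Superposition of the two state sequences. Adding a scaled trajectory is the step by
  which a combination of Hankel columns is built up later.\<close>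

lemma LTI_axpy:
  assumes "\<B> \<in> LTI m p" "(u1, y1) \<in> \<B>" "(u2, y2) \<in> \<B>"
  shows "(\<lambda>t. u1 t + c \<cdot>\<^sub>v u2 t, \<lambda>t. y1 t + c \<cdot>\<^sub>v y2 t) \<in> \<B>"
proof -
  obtain n A B C D where sys: "is_system n m p A B C D" and \<B>: "\<B> = system_behavior n m p A B C D"
    using assms(1) unfolding LTI_def represents_def by blast
  obtain x1 x2 where x: "state_trajectory n A B C D u1 x1 y1" "state_trajectory n A B C D u2 x2 y2"
    using assms(2,3) unfolding \<B> mem_system_behavior_iff by blast
  note car = LTI_carrier[OF assms(1,2)] LTI_carrier[OF assms(1,3)]
  \<comment> \<open>Serves both system equations: \<open>r = n\<close> for the state update,
    \<open>r = p\<close> for the output.\<close>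
  have sum: "M *\<^sub>v (v + c \<cdot>\<^sub>v v') + N *\<^sub>v (w + c \<cdot>\<^sub>v w')
      = (M *\<^sub>v v + N *\<^sub>v w) + c \<cdot>\<^sub>v (M *\<^sub>v v' + N *\<^sub>v w')"
    if "M \<in> carrier_mat r n" "N \<in> carrier_mat r m" "v \<in> carrier_vec n" "v' \<in> carrier_vec n"
      "w \<in> carrier_vec m" "w' \<in> carrier_vec m" for M N :: "real mat" and r v v' w w'
  proof -
    have "M *\<^sub>v v \<in> carrier_vec r" "M *\<^sub>v v' \<in> carrier_vec r" "N *\<^sub>v w \<in> carrier_vec r" "N *\<^sub>v w' \<in> carrier_vec r"
      using that by auto
    then show ?thesis
      using that(1,2) unfolding mult_mat_vec_axpy[OF that(1,3,4)] mult_mat_vec_axpy[OF that(2,5,6)]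
      by (intro eq_vecI) (auto simp: algebra_simps)
  qed
  have "state_trajectory n A B C D (\<lambda>t. u1 t + c \<cdot>\<^sub>v u2 t) (\<lambda>t. x1 t + c \<cdot>\<^sub>v x2 t) (\<lambda>t. y1 t + c \<cdot>\<^sub>v y2 t)"
    using x sys car unfolding state_trajectory_def is_system_def
    by (simp add: sum[where r = n] sum[where r = p])
  then show ?thesis
    using car unfolding \<B> mem_system_behavior_iff by auto
qed

text \<open>The state at time \<open>s\<close> becomes the initial state, which is
  unconstrained.\<close>

lemma LTI_shift:
  assumes "\<B> \<in> LTI m p" "(u, y) \<in> \<B>"
  shows "(\<lambda>t. u (s + t), \<lambda>t. y (s + t)) \<in> \<B>"
proof -
  obtain n A B C D where \<B>: "\<B> = system_behavior n m p A B C D"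
    using assms(1) unfolding LTI_def represents_def by blast
  obtain x where "state_trajectory n A B C D u x y"
    using assms(2) unfolding \<B> mem_system_behavior_iff by blast
  then have "state_trajectory n A B C D (\<lambda>t. u (s + t)) (\<lambda>t. x (s + t)) (\<lambda>t. y (s + t))"
    unfolding state_trajectory_def by simp
  then show ?thesis
    using LTI_carrier[OF assms] unfolding \<B> mem_system_behavior_iff by auto
qed

text \<open>Causality: the system is run from the same initial state with the new input, and outputs
  before \<open>T\<close> involve only inputs before \<open>T\<close>.\<close>

lemma LTI_extend:
  assumes "\<B> \<in> LTI m p" "(u, y) \<in> \<B>" and v: "\<And>t. v t \<in> carrier_vec m"
    and uv: "\<And>t. t < T \<Longrightarrow> v t = u t"
  shows "\<exists>y'. (v, y') \<in> \<B> \<and> (\<forall>t<T. y' t = y t)"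
proof -
  obtain n A B C D where sys: "is_system n m p A B C D" and \<B>: "\<B> = system_behavior n m p A B C D"
    using assms(1) unfolding LTI_def represents_def by blast
  obtain x where x: "state_trajectory n A B C D u x y"
    using assms(2) unfolding \<B> mem_system_behavior_iff by blast
  define z where "z = rec_nat (x 0) (\<lambda>t z. A *\<^sub>v z + B *\<^sub>v v t)"
  have z0: "z 0 = x 0" and zS: "z (Suc t) = A *\<^sub>v z t + B *\<^sub>v v t" for t
    by (simp_all add: z_def)
  have z: "z t \<in> carrier_vec n" for t
    by (induction t) (use sys x v in \<open>auto simp: z0 zS is_system_def state_trajectory_def\<close>)
  define y' where "y' = (\<lambda>t. C *\<^sub>v z t + D *\<^sub>v v t)"
  have "(v, y') \<in> \<B>"
    unfolding \<B> mem_system_behavior_iff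
  proof (intro conjI allI exI)
    show "state_trajectory n A B C D v z y'"
      unfolding state_trajectory_def y'_def using z zS by simp
    show "y' t \<in> carrier_vec p" for t
      unfolding y'_def using sys z[of t] v[of t] unfolding is_system_def by auto
  qed (rule v)
  \<comment> \<open>The states agree up to and including \<open>T\<close>, since the state at
    \<open>T\<close> involves only earlier inputs; the outputs agree strictly before
    \<open>T\<close>, because of the direct term \<open>D\<close>.\<close>
  moreover have "t \<le> T \<Longrightarrow> z t = x t" for t
    by (induction t) (use x uv in \<open>auto simp: z0 zS state_trajectory_def\<close>)
  then have "t < T \<Longrightarrow> y' t = y t" for t
    using x uv[of t] unfolding y'_def state_trajectory_def by simp
  ultimately show ?thesis by blast
qed

text \<open>The difference of the two state trajectories is autonomous as long as the inputs agree.\<close>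

lemma output_determined_by_lag:
  assumes "\<B> \<in> LTI m p" and lag: "lag m p \<B> \<le> l"
    and "(u, y) \<in> \<B>" "(u', y') \<in> \<B>"
    and u: "\<And>t. t < T \<Longrightarrow> u t = u' t"
    and y: "\<And>t. t < l \<Longrightarrow> y t = y' t"
    and "l \<le> T" "t < T"
  shows "y t = y' t"
proof -
  obtain n A B C D where sys: "is_system n m p A B C D" and \<B>: "\<B> = system_behavior n m p A B C D"
    and l: "lag m p \<B> = system_lag A C"
    using LTI_representation_of_lag[OF assms(1)] by blast
  obtain x x' where x: "state_trajectory n A B C D u x y" and x': "state_trajectory n A B C D u' x' y'"
    using assms(3,4) unfolding \<B> mem_system_behavior_iff by blast
  have A: "A \<in> carrier_mat n n" and B: "B \<in> carrier_mat n m" and C: "C \<in> carrier_mat p n"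
    and D: "D \<in> carrier_mat p m"
    using sys unfolding is_system_def by auto
  have xc: "x t \<in> carrier_vec n" "x' t \<in> carrier_vec n" for t
    using x x' unfolding state_trajectory_def by auto
  have uc: "u t \<in> carrier_vec m" for t
    by (rule LTI_carrier[OF assms(1,3)])
  \<comment> \<open>\<open>x - x'\<close> obeys the autonomous recursion only while the inputs
    agree. Iterating \<open>A\<close> from its initial value gives a sequence that is autonomous for
    all times and equals \<open>x - x'\<close> up to \<open>T\<close>.\<close>
  define z where "z t = (((*\<^sub>v) A) ^^ t) (x 0 - x' 0)" for t
  have zS: "z (Suc t) = A *\<^sub>v z t" for t by (simp add: z_def)
  have zc: "z t \<in> carrier_vec n" for t
    by (induction t) (use xc A in \<open>auto simp: zS z_def\<close>)
  have z_eq: "t \<le> T \<Longrightarrow> z t = x t - x' t" for t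
  proof (induction t)
    case (Suc t)
    have "x (Suc t) - x' (Suc t) = A *\<^sub>v x t - A *\<^sub>v x' t"
      using x x' u[of t] Suc.prems A B xc[of t] uc[of t] unfolding state_trajectory_def
      by (intro eq_vecI) auto
    also have "\<dots> = A *\<^sub>v (x t - x' t)"
      using A xc by (simp add: mult_minus_distrib_mat_vec)
    finally show ?case using Suc by (simp add: zS)
  qed (simp add: z_def)
  have Cz: "C *\<^sub>v z t = y t - y' t" if "t < T" for t
  proof -
    have "y t - y' t = C *\<^sub>v x t - C *\<^sub>v x' t"
      using x x' u[of t] that C D xc[of t] uc[of t] unfolding state_trajectory_def
      by (intro eq_vecI) auto
    then show ?thesis
      using C xc z_eq[of t] that by (simp add: mult_minus_distrib_mat_vec)
  qed
  have yc: "y t \<in> carrier_vec p" "y' t \<in> carrier_vec p" for t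
    using LTI_carrier[OF assms(1,3)] LTI_carrier[OF assms(1,4)] by auto
  have "C *\<^sub>v z t = 0\<^sub>v p"
  proof (rule output_zero_beyond_system_lag[where x = z, OF A C zc zS])
    fix s assume "s < system_lag A C"
    then have "s < l" using l lag by simp
    then show "C *\<^sub>v z s = 0\<^sub>v p"
      using Cz[of s] y[of s] yc[of s] \<open>l \<le> T\<close> by simp
  qed
  then have diff: "y t - y' t = 0\<^sub>v p" using Cz \<open>t < T\<close> by simp
  show ?thesis
  proof (rule eq_vecI)
    fix i assume "i < dim_vec (y' t)"
    then show "y t $ i = y' t $ i"
      using arg_cong[OF diff, of "\<lambda>v. v $ i"] yc[of t] by simp
  qed (use yc[of t] in simp)
qed

section \<open>Stacked vectors and Hankel columns\<close>

lemma stack_carrier [simp]: "stack q T w \<in> carrier_vec (q * T)"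
  by (simp add: stack_def)

lemma dim_stack [simp]: "dim_vec (stack q T w) = q * T"
  by (simp add: stack_def)

lemma stack_index:
  assumes "i < q" "t < T"
  shows "stack q T w $ (q * t + i) = w t $ i"
proof -
  have "q * t + i < q * Suc t" using assms(1) by simp
  also have "\<dots> \<le> q * T" using assms(2) by (intro mult_le_mono2) simp
  finally show ?thesis using assms(1) by (simp add: stack_def)
qed

lemma stack_append: "stack q (a + b) w = stack q a w @\<^sub>v stack q b (\<lambda>t. w (a + t))"
proof (rule eq_vecI)
  fix i assume "i < dim_vec (stack q a w @\<^sub>v stack q b (\<lambda>t. w (a + t)))"
  then have i: "i < q * a + q * b" by simp
  show "stack q (a + b) w $ i = (stack q a w @\<^sub>v stack q b (\<lambda>t. w (a + t))) $ i"
  proof (cases "i < q * a")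
    case False
    then obtain j where j: "i = q * a + j" by (metis le_add_diff_inverse not_less)
    \<comment> \<open>The index range is empty for \<open>q = 0\<close>; positivity lets
      \<open>div\<close> and \<open>mod\<close> split off the offset \<open>q * a\<close>.\<close>
    with i have "q > 0" by (cases q) auto
    then show ?thesis using i j by (simp add: stack_def algebra_simps)
  qed (use i in \<open>simp add: stack_def algebra_simps\<close>)
qed (simp add: algebra_simps)

lemma stack_eq_iff:
  assumes "\<And>t. w t \<in> carrier_vec q" "\<And>t. w' t \<in> carrier_vec q"
  shows "stack q T w = stack q T w' \<longleftrightarrow> (\<forall>t<T. w t = w' t)"
proof
  assume eq: "stack q T w = stack q T w'"
  show "\<forall>t<T. w t = w' t"
  proof (intro allI impI eq_vecI)
    fix t i assume "t < T" "i < dim_vec (w' t)"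
    then show "w t $ i = w' t $ i"
      using stack_index[of i q t T w] stack_index[of i q t T w'] assms[of t] eq by simp
  qed (use assms in \<open>metis carrier_vecD\<close>)
next
  assume "\<forall>t<T. w t = w' t"
  then show "stack q T w = stack q T w'"
    by (intro eq_vecI) (auto simp: stack_def less_mult_imp_div_less mult.commute)
qed

lemma stack_surj:
  assumes "v \<in> carrier_vec (q * T)"
  obtains w where "\<And>t. w t \<in> carrier_vec q" "v = stack q T w"
proof
  \<comment> \<open>From time \<open>T\<close> on the witness reads unspecified entries beyond the
    end of \<open>v\<close>; there only the dimension \<open>q\<close> of each sample
    matters.\<close>
  show "v = stack q T (\<lambda>t. vec q (\<lambda>i. v $ (q * t + i)))"
  proof (rule eq_vecI)
    fix i assume "i < dim_vec (stack q T (\<lambda>t. vec q (\<lambda>i. v $ (q * t + i))))"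
    then have i: "i < q * T" by simp
    then have "q > 0" by (cases q) auto
    then show "v $ i = stack q T (\<lambda>t. vec q (\<lambda>i. v $ (q * t + i))) $ i"
      using i by (simp add: stack_def)
  qed (use assms in simp)
qed simp

lemma vec_last_stack:
  assumes "l \<le> T"
  shows "vec_last (stack q T w) (q * l) = stack q l (\<lambda>t. w (T - l + t))"
proof -
  have "stack q T w = stack q (T - l) w @\<^sub>v stack q l (\<lambda>t. w (T - l + t))"
    using stack_append[of q "T - l" l w] assms by simp
  then show ?thesis by (auto simp: vec_last_def intro!: eq_vecI)
qed

lemma dim_hankel [simp]:
  "dim_row (hankel q T k w) = q * k"
  "dim_col (hankel q T k w) = (if T < k then 0 else T - k + 1)"
  by (simp_all add: hankel_def)

lemma col_hankel_stack:
  assumes "k \<le> T" "j \<le> T - k"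
  shows "col (hankel q T k (stack q T w)) j = stack q k (\<lambda>t. w (j + t))"
proof (rule eq_vecI)
  fix i assume "i < dim_vec (stack q k (\<lambda>t. w (j + t)))"
  then have i: "i < q * k" by simp
  then have "q > 0" by (cases q) auto
  \<comment> \<open>The window starting at \<open>j\<close> ends inside the data, so the Hankel
    entry is a genuine entry of the stacked vector.\<close>
  have "q * j + q * k \<le> q * T"
    using assms mult_le_mono2[of "j + k" T q] by (simp add: add_mult_distrib2)
  then have "q * j + i < q * T" using i by linarith
  then show "col (hankel q T k (stack q T w)) j $ i = stack q k (\<lambda>t. w (j + t)) $ i"
    using assms i \<open>q > 0\<close> by (simp add: hankel_def stack_def)
qed (use assms in simp)

section \<open>Windows of a behavior as a linear space\<close>

text \<open>The pairs of \<open>restr\<close> glued into single vectors, the format of the columns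
  of the data matrix.\<close>

definition windows :: "nat \<Rightarrow> nat \<Rightarrow> behavior \<Rightarrow> nat \<Rightarrow> real vec set" where
  "windows m p \<B> T = {stack m T u @\<^sub>v stack p T y | u y. (u, y) \<in> \<B>}"

lemma stack_axpy:
  assumes "\<And>t. w t \<in> carrier_vec q" "\<And>t. w' t \<in> carrier_vec q"
  shows "stack q T (\<lambda>t. w t + c \<cdot>\<^sub>v w' t) = stack q T w + c \<cdot>\<^sub>v stack q T w'"
proof (rule eq_vecI)
  fix i assume "i < dim_vec (stack q T w + c \<cdot>\<^sub>v stack q T w')"
  then have i: "i < q * T" by simp
  then have "i mod q < q" by (cases q) auto
  then show "stack q T (\<lambda>t. w t + c \<cdot>\<^sub>v w' t) $ i = (stack q T w + c \<cdot>\<^sub>v stack q T w') $ i"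
    using i assms(1)[of "i div q"] assms(2)[of "i div q"] by (simp add: stack_def)
qed simp

lemma windows_zero:
  assumes "\<B> \<in> LTI m p"
  shows "0\<^sub>v (m * T + p * T) \<in> windows m p \<B> T"
proof -
  have "stack q T (\<lambda>_. 0\<^sub>v q) = 0\<^sub>v (q * T)" for q
    by (rule eq_vecI; cases q) (auto simp: stack_def)
  then have "0\<^sub>v (m * T + p * T) = stack m T (\<lambda>_. 0\<^sub>v m) @\<^sub>v stack p T (\<lambda>_. 0\<^sub>v p)"
    by auto
  then show ?thesis using LTI_zero[OF assms] unfolding windows_def by blast
qed

lemma windows_axpy:
  assumes "\<B> \<in> LTI m p" "v \<in> windows m p \<B> T" "w \<in> windows m p \<B> T"
  shows "v + c \<cdot>\<^sub>v w \<in> windows m p \<B> T"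
proof -
  obtain u1 y1 u2 y2 where 1: "(u1, y1) \<in> \<B>" "v = stack m T u1 @\<^sub>v stack p T y1"
    and 2: "(u2, y2) \<in> \<B>" "w = stack m T u2 @\<^sub>v stack p T y2"
    using assms(2,3) unfolding windows_def by blast
  note car = LTI_carrier[OF assms(1) 1(1)] LTI_carrier[OF assms(1) 2(1)]
  have "v + c \<cdot>\<^sub>v w = stack m T (\<lambda>t. u1 t + c \<cdot>\<^sub>v u2 t) @\<^sub>v stack p T (\<lambda>t. y1 t + c \<cdot>\<^sub>v y2 t)"
    unfolding stack_axpy[OF car(1,3)] stack_axpy[OF car(2,4)] 1(2) 2(2)
    by (intro eq_vecI) auto
  then show ?thesis
    using LTI_axpy[OF assms(1) 1(1) 2(1)] unfolding windows_def by blast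
qed

text \<open>The product is built by adding \<open>g $ k\<close> times column \<open>k\<close>, one
  column at a time, and each partial sum stays in \<open>S\<close>.\<close>

lemma mult_mat_vec_mem_if_cols_mem:
  fixes M :: "'a :: comm_semiring_1 mat"
  assumes M: "M \<in> carrier_mat r n" and g: "g \<in> carrier_vec n"
    and zero: "0\<^sub>v r \<in> S" and axpy: "\<And>v w c. v \<in> S \<Longrightarrow> w \<in> S \<Longrightarrow> v + c \<cdot>\<^sub>v w \<in> S"
    and cols: "\<And>j. j < n \<Longrightarrow> col M j \<in> S"
  shows "M *\<^sub>v g \<in> S"
proof -
  have "k \<le> n \<Longrightarrow> vec r (\<lambda>i. \<Sum>j<k. M $$ (i, j) * g $ j) \<in> S" for k
  proof (induction k)
    case 0
    have "vec r (\<lambda>i. 0) = (0\<^sub>v r :: 'a vec)" by auto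
    then show ?case using zero by simp
  next
    case (Suc k)
    have "vec r (\<lambda>i. \<Sum>j<Suc k. M $$ (i, j) * g $ j) = vec r (\<lambda>i. \<Sum>j<k. M $$ (i, j) * g $ j) + g $ k \<cdot>\<^sub>v col M k"
      using Suc.prems M by (intro eq_vecI) (auto simp: mult.commute)
    then show ?case using Suc axpy cols by simp
  qed
  from this[of n] have "vec r (\<lambda>i. \<Sum>j<n. M $$ (i, j) * g $ j) \<in> S" by simp
  moreover have "M *\<^sub>v g = vec r (\<lambda>i. \<Sum>j<n. M $$ (i, j) * g $ j)"
    using M g by (intro eq_vecI) (auto simp: scalar_prod_def lessThan_atLeast0)
  ultimately show ?thesis by simp
qed

section \<open>The data matrix and the output of the procedure\<close>

lemma row_block_mult_vec:
  assumes "r + k \<le> dim_row M"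
  shows "row_block M r k *\<^sub>v g = vec k (\<lambda>i. (M *\<^sub>v g) $ (r + i))"
proof (rule eq_vecI)
  fix i assume "i < dim_vec (vec k (\<lambda>i. (M *\<^sub>v g) $ (r + i)))"
  then have i: "i < k" by simp
  then have "row (row_block M r k) i = row M (r + i)"
    using assms by (intro eq_vecI) (auto simp: row_block_def)
  then show "(row_block M r k *\<^sub>v g) $ i = vec k (\<lambda>i. (M *\<^sub>v g) $ (r + i)) $ i"
    using i assms by (simp add: row_block_def)
qed (simp add: row_block_def)

text \<open>The matrix \<open>M\<close> inside \<open>predict\<close>. All input rows precede all
  output rows, as in \<open>windows\<close>.\<close>

definition data_mat :: "nat \<Rightarrow> nat \<Rightarrow> nat \<Rightarrow> nat \<Rightarrow> nat \<Rightarrow> real vec \<Rightarrow> real vec \<Rightarrow> real vec \<Rightarrow> real vec \<Rightarrow> real mat" where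
  "data_mat m p T T' k ud yd ui yi =
     four_block_mat (hankel m T k ud) (hankel m T' k ui) (hankel p T k yd) (hankel p T' k yi)"

lemma data_mat_carrier:
  "data_mat m p T T' k ud yd ui yi \<in>
     carrier_mat (m * k + p * k) (dim_col (hankel m T k ud) + dim_col (hankel m T' k ui))"
  unfolding data_mat_def by (intro carrier_matI) auto

lemma data_mat_mult_vec_mem_windows:
  assumes \<B>: "\<B> \<in> LTI m p" and d: "(ud, yd) \<in> restr m p \<B> T" and i: "(ui, yi) \<in> restr m p \<B> T'"
    and g: "g \<in> carrier_vec (dim_col (data_mat m p T T' k ud yd ui yi))"
  shows "data_mat m p T T' k ud yd ui yi *\<^sub>v g \<in> windows m p \<B> k"
proof (rule mult_mat_vec_mem_if_cols_mem[OF data_mat_carrier _ windows_zero[OF \<B>] windows_axpy[OF \<B>]])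
  let ?n = "dim_col (hankel m T k ud)" and ?n' = "dim_col (hankel m T' k ui)"
  show "g \<in> carrier_vec (?n + ?n')"
    using g data_mat_carrier[of m p T T' k ud yd ui yi] by (metis carrier_matD(2))
  have window: "col (hankel m S k a) j @\<^sub>v col (hankel p S k b) j \<in> windows m p \<B> k"
    if ab: "(a, b) \<in> restr m p \<B> S" and j: "j < dim_col (hankel m S k a)" for a b S j
  proof -
    obtain u y where uy: "a = stack m S u" "b = stack p S y" "(u, y) \<in> \<B>"
      using ab unfolding restr_def by auto
    \<comment> \<open>A void Hankel matrix has no columns, so the existence of column
      \<open>j\<close> excludes data shorter than the window.\<close>
    have "k \<le> S" "j \<le> S - k" using j by (auto split: if_splits)
    then show ?thesis
      using LTI_shift[OF \<B> uy(3), of j] unfolding uy windows_def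
      by (auto simp: col_hankel_stack)
  qed
  fix j assume j: "j < ?n + ?n'"
  have "col (data_mat m p T T' k ud yd ui yi) j =
      (if j < ?n then col (hankel m T k ud) j @\<^sub>v col (hankel p T k yd) j
       else col (hankel m T' k ui) (j - ?n) @\<^sub>v col (hankel p T' k yi) (j - ?n))"
    unfolding data_mat_def using j
    by (intro eq_vecI) (auto split: if_splits)
  then show "col (data_mat m p T T' k ud yd ui yi) j \<in> windows m p \<B> k"
    using window[OF d, of j] window[OF i, of "j - ?n"] j by auto
qed

text \<open>The vector \<open>g\<close> depends on the data alone, whereas the trajectory behind the
  product depends on the behavior. Hence \<open>g\<close> is fixed first and the four block
  equations are read off for every \<open>u\<close> and \<open>y\<close> that produce the
  product.\<close>

lemma predict_some_obtains:
  assumes "Some yf \<in> predict m p T Tini Tf ud yd uini yini uf l"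
  obtains g where "g \<in> carrier_vec (dim_col (data_mat m p T Tini (l + Tf) ud yd uini yini))"
    "\<And>u y. data_mat m p T Tini (l + Tf) ud yd uini yini *\<^sub>v g = stack m (l + Tf) u @\<^sub>v stack p (l + Tf) y \<Longrightarrow>
      stack m l u = vec_last uini (m * l) \<and> stack m Tf (\<lambda>t. u (l + t)) = uf \<and>
      stack p l y = vec_last yini (p * l) \<and> stack p Tf (\<lambda>t. y (l + t)) = yf"
proof -
  define k where "k = l + Tf"
  define M where "M = data_mat m p T Tini k ud yd uini yini"
  have rows: "dim_row M = m * k + p * k"
    using data_mat_carrier unfolding M_def by blast
  obtain g where g: "g \<in> carrier_vec (dim_col M)" and "row_block M 0 (m * l) *\<^sub>v g = vec_last uini (m * l)"
    "row_block M (m * l) (m * Tf) *\<^sub>v g = uf" "row_block M (m * k) (p * l) *\<^sub>v g = vec_last yini (p * l)"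
    "row_block M (m * k + p * l) (p * Tf) *\<^sub>v g = yf"
    using assms unfolding predict_def Let_def data_mat_def[symmetric] k_def M_def
    by (auto split: if_splits)
  note eqs = this(2-5)
  show ?thesis
  proof (rule that[of g])
    fix u y
    assume "data_mat m p T Tini (l + Tf) ud yd uini yini *\<^sub>v g = stack m (l + Tf) u @\<^sub>v stack p (l + Tf) y"
    \<comment> \<open>Cutting both windows after \<open>l\<close> samples gives four consecutive
      segments, matching the row blocks \<open>Up\<close>, \<open>Uf\<close>, \<open>Yp\<close>,
      \<open>Yf\<close>.\<close>
    then have Mg: "M *\<^sub>v g = (stack m l u @\<^sub>v stack m Tf (\<lambda>t. u (l + t))) @\<^sub>v
        stack p l y @\<^sub>v stack p Tf (\<lambda>t. y (l + t))"
      unfolding M_def k_def stack_append by simp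
    have "row_block M 0 (m * l) *\<^sub>v g = stack m l u"
      by (subst row_block_mult_vec) (auto simp: rows k_def Mg algebra_simps intro!: eq_vecI)
    moreover have "row_block M (m * l) (m * Tf) *\<^sub>v g = stack m Tf (\<lambda>t. u (l + t))"
      by (subst row_block_mult_vec) (auto simp: rows k_def Mg algebra_simps intro!: eq_vecI)
    moreover have "row_block M (m * k) (p * l) *\<^sub>v g = stack p l y"
      by (subst row_block_mult_vec) (auto simp: rows k_def Mg algebra_simps intro!: eq_vecI)
    moreover have "row_block M (m * k + p * l) (p * Tf) *\<^sub>v g = stack p Tf (\<lambda>t. y (l + t))"
      by (subst row_block_mult_vec) (auto simp: rows k_def Mg algebra_simps intro!: eq_vecI)
    ultimately show "stack m l u = vec_last uini (m * l) \<and> stack m Tf (\<lambda>t. u (l + t)) = uf \<and>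
      stack p l y = vec_last yini (p * l) \<and> stack p Tf (\<lambda>t. y (l + t)) = yf"
      using eqs by simp
  qed (use g in \<open>simp add: M_def k_def\<close>)
qed

section \<open>Prediction for one behavior and for all explaining behaviors\<close>

lemma restr_append_iff:
  assumes "a \<in> carrier_vec (m * S)" "b \<in> carrier_vec (p * S)"
  shows "(a @\<^sub>v c, b @\<^sub>v d) \<in> restr m p \<B> (S + T) \<longleftrightarrow>
    (\<exists>u y. (u, y) \<in> \<B> \<and> stack m S u = a \<and> stack m T (\<lambda>t. u (S + t)) = c \<and>
       stack p S y = b \<and> stack p T (\<lambda>t. y (S + t)) = d)"
  unfolding restr_def stack_append
  using append_vec_eq[OF assms(1) stack_carrier] append_vec_eq[OF assms(2) stack_carrier] by auto

text \<open>One direction is uniqueness: any continuation, shifted, shares inputs and first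
  \<open>l\<close> outputs with the trajectory built from \<open>g\<close>. The other is existence:
  causality yields some continuation, and uniqueness identifies its output as
  \<open>yf\<close>.\<close>

lemma prediction_iff:
  assumes \<B>: "\<B> \<in> LTI m p" and lag: "lag m p \<B> \<le> l" and l: "l \<le> Tini"
    and d: "(ud, yd) \<in> restr m p \<B> T" and i: "(uini, yini) \<in> restr m p \<B> Tini"
    and uf: "uf \<in> carrier_vec (m * Tf)"
    and pred: "Some yf \<in> predict m p T Tini Tf ud yd uini yini uf l"
  shows "(uini @\<^sub>v uf, yini @\<^sub>v yf') \<in> restr m p \<B> (Tini + Tf) \<longleftrightarrow> yf' = yf"
proof -
  have ini_car: "uini \<in> carrier_vec (m * Tini)" "yini \<in> carrier_vec (p * Tini)"
    using i unfolding restr_def by auto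
  note restr_iff = restr_append_iff[OF ini_car]
  obtain g where g: "g \<in> carrier_vec (dim_col (data_mat m p T Tini (l + Tf) ud yd uini yini))"
    and split: "\<And>u y. data_mat m p T Tini (l + Tf) ud yd uini yini *\<^sub>v g =
        stack m (l + Tf) u @\<^sub>v stack p (l + Tf) y \<Longrightarrow>
      stack m l u = vec_last uini (m * l) \<and> stack m Tf (\<lambda>t. u (l + t)) = uf \<and>
      stack p l y = vec_last yini (p * l) \<and> stack p Tf (\<lambda>t. y (l + t)) = yf"
    using predict_some_obtains[OF pred] by metis
  obtain u y where uy: "(u, y) \<in> \<B>" and
    Mg: "data_mat m p T Tini (l + Tf) ud yd uini yini *\<^sub>v g = stack m (l + Tf) u @\<^sub>v stack p (l + Tf) y"
    using data_mat_mult_vec_mem_windows[OF \<B> d i g] unfolding windows_def by blast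
  have u_ini: "stack m l u = vec_last uini (m * l)" and u_f: "stack m Tf (\<lambda>t. u (l + t)) = uf" and
    y_ini: "stack p l y = vec_last yini (p * l)" and y_f: "stack p Tf (\<lambda>t. y (l + t)) = yf"
    using split[OF Mg] by blast+
  note uy_car = LTI_carrier[OF \<B> uy]
  have unique: "yf' = yf" if "(uini @\<^sub>v uf, yini @\<^sub>v yf') \<in> restr m p \<B> (Tini + Tf)" for yf'
  proof -
    from that[unfolded restr_iff] obtain v z where vz: "(v, z) \<in> \<B>" and v: "stack m Tini v = uini"
      "stack m Tf (\<lambda>t. v (Tini + t)) = uf" and z: "stack p Tini z = yini" "stack p Tf (\<lambda>t. z (Tini + t)) = yf'"
      by blast
    \<comment> \<open>This shift aligns the last \<open>l\<close> samples of the initial data with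
      the first \<open>l\<close> samples of the trajectory built from \<open>g\<close>.\<close>
    define s where "s = Tini - l"
    note vz_car = LTI_carrier[OF \<B> vz]
    have sl: "s + (l + t) = Tini + t" for t using l s_def by simp
    have in1: "u t = v (s + t)" if "t < l" for t
      using u_ini that unfolding v(1)[symmetric] vec_last_stack[OF l] s_def[symmetric]
      by (subst (asm) stack_eq_iff) (auto intro: uy_car vz_car)
    have in2: "u (l + t) = v (s + (l + t))" if "t < Tf" for t
      using u_f that unfolding v(2)[symmetric] sl
      by (subst (asm) stack_eq_iff) (auto intro: uy_car vz_car)
    have out1: "y t = z (s + t)" if "t < l" for t
      using y_ini that unfolding z(1)[symmetric] vec_last_stack[OF l] s_def[symmetric]
      by (subst (asm) stack_eq_iff) (auto intro: uy_car vz_car)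
    have "u t = v (s + t)" if "t < l + Tf" for t
      using in1[of t] in2[of "t - l"] that by (cases "t < l") auto
    then have "y t = z (s + t)" if "t < l + Tf" for t
      using output_determined_by_lag[OF \<B> lag uy LTI_shift[OF \<B> vz, of s], of "l + Tf" t] out1 that by auto
    then have "\<forall>t<Tf. y (l + t) = z (Tini + t)"
      unfolding sl[symmetric] by simp
    then show ?thesis
      unfolding y_f[symmetric] z(2)[symmetric]
      by (subst stack_eq_iff) (auto intro: uy_car vz_car)
  qed
  \<comment> \<open>Existence: a trajectory through the initial data has its input replaced by
    \<open>uf\<close> from time \<open>Tini\<close> on, which leaves the initial outputs
    unchanged.\<close>
  obtain v z where vz: "(v, z) \<in> \<B>" "uini = stack m Tini v" "yini = stack p Tini z"
    using i unfolding restr_def by blast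
  obtain w where w: "\<And>t. w t \<in> carrier_vec m" "uf = stack m Tf w"
    using stack_surj[OF uf] by blast
  define v' where "v' t = (if t < Tini then v t else w (t - Tini))" for t
  have v': "v' t \<in> carrier_vec m" for t
    using w(1) LTI_carrier(1)[OF \<B> vz(1)] by (simp add: v'_def)
  have v'_eq: "v' t = v t" if "t < Tini" for t
    using that by (simp add: v'_def)
  obtain z' where z': "(v', z') \<in> \<B>" "\<And>t. t < Tini \<Longrightarrow> z' t = z t"
    using LTI_extend[where v = v' and T = Tini, OF \<B> vz(1) v' v'_eq] by blast
  have "stack m Tini v' = uini"
    unfolding vz(2) by (subst stack_eq_iff) (auto simp: v'_def intro: LTI_carrier[OF \<B> vz(1)] w(1))
  moreover have "stack m Tf (\<lambda>t. v' (Tini + t)) = uf"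
    unfolding w(2) by (simp add: v'_def)
  moreover have "stack p Tini z' = yini"
    unfolding vz(3) by (subst stack_eq_iff) (auto simp: z'(2) intro: LTI_carrier[OF \<B> vz(1)] LTI_carrier[OF \<B> z'(1)])
  ultimately have "(uini @\<^sub>v uf, yini @\<^sub>v stack p Tf (\<lambda>t. z' (Tini + t))) \<in> restr m p \<B> (Tini + Tf)"
    using z'(1) unfolding restr_iff by blast
  with unique show ?thesis by blast
qed

theorem lemma6:
  fixes m p L N T Tini Tf :: nat
    and Bstar :: behavior
    and ud yd uini yini uf yf :: "real vec"
  assumes "Bstar \<in> LTI m p"
    and "lag m p Bstar \<le> L"
    and "state_dim m p Bstar \<le> N"
    and "(ud, yd) \<in> restr m p Bstar T"
    and "(uini, yini) \<in> restr m p Bstar Tini"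
    and "uf \<in> carrier_vec (m * Tf)"
    and "Tini \<ge> L_max m p L N T Tini ud yd uini yini"
    and "Some yf \<in> predict m p T Tini Tf ud yd uini yini uf (L_max m p L N T Tini ud yd uini yini)"
  shows "informative m p L N T Tini Tf ud yd uini yini uf \<and>
         yf = unique_prediction m p L N T Tini Tf ud yd uini yini uf"
proof -
  let ?\<Sigma> = "explaining m p L N T ud yd \<inter> explaining m p L N Tini uini yini"
  \<comment> \<open>The data-generating behavior makes the set of explaining behaviors nonempty, so
    that a common prediction is pinned down below.\<close>
  have Bstar: "Bstar \<in> ?\<Sigma>"
    using assms(1-5) by (simp add: explaining_def model_class_def)
  \<comment> \<open>All lags in question are at most \<open>L\<close>; finiteness makes
    \<open>Max\<close> an upper bound for them.\<close>
  have fin: "finite {lag m p \<B> | \<B>. \<B> \<in> ?\<Sigma>}"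
    by (rule finite_subset[of _ "{..L}"]) (auto simp: explaining_def model_class_def)
  \<comment> \<open>The same \<open>yf\<close> appears for every explaining behavior, which yields
    both the individual uniqueness and the common prediction.\<close>
  have iff: "(uini @\<^sub>v uf, yini @\<^sub>v yf') \<in> restr m p \<B> (Tini + Tf) \<longleftrightarrow> yf' = yf" if "\<B> \<in> ?\<Sigma>" for \<B> yf'
  proof (rule prediction_iff[OF _ _ assms(7) _ _ assms(6,8)])
    show "lag m p \<B> \<le> L_max m p L N T Tini ud yd uini yini"
      unfolding L_max_def by (rule Max_ge[OF fin]) (use that in blast)
  qed (use that in \<open>auto simp: explaining_def model_class_def\<close>)
  have yf: "yf \<in> carrier_vec (p * Tf)"
    using assms(8) unfolding predict_def Let_def
    by (auto split: if_splits simp: row_block_def intro!: carrier_vecI)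
  have common: "common_prediction m p L N T Tini Tf ud yd uini yini uf yf' \<longleftrightarrow> yf' = yf" for yf'
    unfolding common_prediction_def using iff yf Bstar by blast
  then have "unique_prediction m p L N T Tini Tf ud yd uini yini uf = yf"
    unfolding unique_prediction_def by (intro the_equality) auto
  moreover have "informative m p L N T Tini Tf ud yd uini yini uf"
    unfolding informative_def common using iff yf by auto
  ultimately show ?thesis by simp
qed

end
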